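(* For every $k\in\mathbb{Z}$ and every integer $n\ge 0$: 1) \[ D_n^{(k)}=4\sum_{m=0}^{\lfloor n/2\rfloor}\frac{1}{(2m+1)^{k+1}}\sum_{p=1}^{2m+1}\sum_{q=0}^{n-2m}(2^{p+q+1}-1)\binom{n}{q}\begin{bmatrix}2m+1\\ p\end{bmatrix}\left\{\begin{matrix}n-q\\ 2m\end{matrix}\right\}\frac{B_{p+q+1}}{p+q+1}; \] 2) \[ D_n^{(k)}=\sum_{m=0}^{\lfloor n/2\rfloor}\frac{1}{(2m+1)^{k+1}}\sum_{p=2m}^{n}\frac{(-1)^p(p+1)!}{2^p}\binom{p}{2m}\left\{\begin{matrix}n+1\\ p+1\end{matrix}\right\}. \]
   Context: For $k\in\mathbb{Z}$ let $\mathrm{A}_k(z)=2\sum_{n=0}^\infty \frac{z^{2n+1}}{(2n+1)^k}$, regarded as a formal power series. The numbers $D_n^{(k)}$ are defined by $\frac{\mathrm{A}_k(\tanh(t/2))}{\sinh t}=\sum_{n\ge0} D_n^{(k)}\frac{t^n}{n!}$ (formal power series). Here $\begin{bmatrix}n\\ m\end{bmatrix}$ denotes the unsigned Stirling numbers of the first kind (defined by $x(x+1)\cdots(x+n-1)=\sum_m \begin{bmatrix}n\\ m\end{bmatrix}x^m$), $\left\{\begin{matrix}n\\ m\end{matrix}\right\}$ the Stirling numbers of the second kind (with $\left\{\begin{matrix}n\\ m\end{matrix}\right\}=0$ if $n<m$, and $\left\{\begin{matrix}0\\ 0\end{matrix}\right\}=1$), and $B_j$ the Bernoulli numbers defined by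 $\frac{t}{e^t-1}=\sum_{j\ge0}B_j\frac{t^j}{j!}$ (only $B_j$ with $j\ge2$ occur). *)

theory Defs
  imports
    "HOL-Computational_Algebra.Formal_Power_Series"
    "HOL-Combinatorics.Stirling"
begin

text \<open>All power series have rational coefficients. The parameter \<open>c\<close> in the hyperbolic
  functions scales the argument, as in \<^const>\<open>fps_exp\<close>: \<open>fps_sinh c\<close> is sinh (c t).\<close>

definition fps_sinh :: "rat \<Rightarrow> rat fps" where
  "fps_sinh c = fps_const (1/2) * (fps_exp c - fps_exp (- c))"

definition fps_cosh :: "rat \<Rightarrow> rat fps" where
  "fps_cosh c = fps_const (1/2) * (fps_exp c + fps_exp (- c))"

definition fps_tanh :: "rat \<Rightarrow> rat fps" where
  "fps_tanh c = fps_sinh c / fps_cosh c"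

definition fps_A :: "int \<Rightarrow> rat fps" where
  "fps_A k = Abs_fps (\<lambda>j. if odd j then 2 * (1 / of_nat j powi k) else 0)"

text \<open>In the next two definitions the divisor has zero constant term and subdegree 1; the
  quotient is the exact one, see \<open>bernoulli_egf\<close> and \<open>D_egf\<close> below.\<close>

definition bernoulli :: "nat \<Rightarrow> rat" where
  "bernoulli j = fact j * fps_nth (fps_X / (fps_exp 1 - 1)) j"

definition D :: "int \<Rightarrow> nat \<Rightarrow> rat" where
  "D k n = fact n * fps_nth ((fps_A k oo fps_tanh (1/2)) / fps_sinh 1) n"

lemma dvd_of_subdegree_1:
  fixes f g :: "rat fps"
  assumes "fps_nth f 0 = 0" "fps_nth g 0 = 0" "fps_nth g 1 \<noteq> 0"
  shows "g dvd f"
proof -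
  have "g \<noteq> 0" "subdegree g = 1"
    using assms by (auto intro!: subdegreeI)
  moreover have "f \<noteq> 0 \<Longrightarrow> subdegree f \<ge> 1"
    using assms by (intro subdegree_geI) auto
  ultimately show ?thesis
    by (cases "f = 0") (auto simp: fps_dvd_iff)
qed

lemma bernoulli_egf:
  "Abs_fps (\<lambda>j. bernoulli j / fact j) * (fps_exp 1 - 1) = fps_X"
proof -
  have "Abs_fps (\<lambda>j. bernoulli j / fact j) = fps_X / (fps_exp 1 - 1)"
    by (simp add: fps_eq_iff bernoulli_def)
  moreover have "(fps_exp 1 - 1 :: rat fps) dvd fps_X"
    by (rule dvd_of_subdegree_1) auto
  ultimately show ?thesis by simp
qed

lemma D_egf:
  "Abs_fps (\<lambda>n. D k n / fact n) * fps_sinh 1 = fps_A k oo fps_tanh (1/2)"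
proof -
  have "Abs_fps (\<lambda>n. D k n / fact n) = (fps_A k oo fps_tanh (1/2)) / fps_sinh 1"
    by (simp add: fps_eq_iff D_def)
  moreover have "fps_sinh 1 dvd (fps_A k oo fps_tanh (1/2))"
    by (rule dvd_of_subdegree_1) (auto simp: fps_A_def fps_sinh_def)
  ultimately show ?thesis by simp
qed

text \<open>The constant term of tanh vanishes and its denominator is a unit, so the composition
  in \<^const>\<open>D\<close> is the usual substitution of power series.\<close>

lemma fps_tanh_nth_0: "fps_nth (fps_tanh c) 0 = 0"
  by (simp add: fps_tanh_def fps_divide_unit fps_cosh_def fps_sinh_def)

lemma fps_tanh_mult_cosh: "fps_tanh c * fps_cosh c = fps_sinh c"
proof -
  have "fps_nth (fps_cosh c) 0 \<noteq> 0"
    by (simp add: fps_cosh_def)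
  then show ?thesis
    by (simp add: fps_tanh_def fps_divide_unit mult.assoc inverse_mult_eq_1)
qed

end

theory Submission
  imports Defs
begin

text \<open>
  Put \<open>T = tanh (t/2)\<close>, \<open>E = e\<^sup>t\<close> and \<open>J = 1/(E + 1)\<close>, so \<open>T = (E - 1) J\<close>. Expanding \<open>A\<^sub>k\<close> shows that
  the generating function of the \<open>D k n\<close> is the sum of \<open>1/(2m+1)\<^sup>k\<^sup>+\<^sup>1\<close> times
  \<open>H\<^sub>m = 2(2m+1) T\<^sup>2\<^sup>m\<^sup>+\<^sup>1 / sinh t = 4(2m+1) E (E - 1)\<^sup>2\<^sup>m J\<^sup>2\<^sup>m\<^sup>+\<^sup>2\<close>, a series independent of \<open>k\<close>; both
  formulas compute its coefficients.

  For the first, \<open>-J\<close> is the generating function of \<open>(2\<^sup>q\<^sup>+\<^sup>1 - 1) B\<^sub>q\<^sub>+\<^sub>1 / (q+1)\<close>, the operator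
  \<open>\<partial>(\<partial> + 1)\<cdots>(\<partial> + N - 1)\<close>, whose coefficients are Stirling numbers of the first kind, maps it to
  \<open>N! E J\<^sup>N\<^sup>+\<^sup>1\<close>, and \<open>(E - 1)\<^sup>2\<^sup>m / (2m)!\<close> generates the Stirling numbers of the second kind. For the
  second, \<open>H\<^sub>m\<close> is the derivative of \<open>2 T\<^sup>2\<^sup>m\<^sup>+\<^sup>1\<close>, which is \<open>u (-u/2)\<^sup>2\<^sup>m / (1 + u/2)\<^sup>2\<^sup>m\<^sup>+\<^sup>1\<close> at \<open>u = E - 1\<close>
  and is expanded in powers of \<open>u\<close>.
\<close>

section \<open>The kernel series and the reduction of D to it\<close>

definition inv_exp_plus_1 :: "rat fps" where
  "inv_exp_plus_1 = inverse (fps_exp 1 + 1)"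

definition tanh_kernel :: "nat \<Rightarrow> rat fps" where
  "tanh_kernel m = of_nat (4 * (2 * m + 1)) * fps_exp 1 * (fps_exp 1 - 1) ^ (2 * m) *
     inv_exp_plus_1 ^ (2 * m + 2)"

lemma fps_const_fact: "fps_const (fact n :: 'a::field_char_0) = fact n"
  by (metis fps_of_nat of_nat_fact)

lemma inv_exp_plus_1_mult: "inv_exp_plus_1 * (fps_exp 1 + 1) = 1"
  unfolding inv_exp_plus_1_def by (rule inverse_mult_eq_1) simp

lemma exp_mult_inv_exp_plus_1: "fps_exp 1 * inv_exp_plus_1 = 1 - inv_exp_plus_1"
  using inv_exp_plus_1_mult by (simp add: algebra_simps eq_diff_eq)

lemma fps_deriv_inv_exp_plus_1:
  "fps_deriv inv_exp_plus_1 = - fps_exp 1 * inv_exp_plus_1\<^sup>2"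
  unfolding inv_exp_plus_1_def by (subst fps_inverse_deriv) simp_all

lemma fps_tanh_half: "fps_tanh (1/2) = (fps_exp 1 - 1) * inv_exp_plus_1"
proof -
  define h hi :: "rat fps" where "h = fps_exp (1/2)" and "hi = fps_exp (- (1/2))"
  have hh: "h * h = fps_exp 1" and hhi: "h * hi = 1"
    unfolding h_def hi_def by (simp_all flip: fps_exp_add_mult)
  have "fps_const (1/2) * (fps_tanh (1/2) * (h + hi)) = fps_const (1/2) * (h - hi)"
    using fps_tanh_mult_cosh[of "1/2"]
    by (simp add: fps_cosh_def fps_sinh_def h_def hi_def mult_ac)
  then have "fps_tanh (1/2) * (h + hi) = h - hi"
    by (metis fps_const_nonzero_eq_nonzero mult_left_cancel zero_neq_numeral divide_eq_0_iff zero_neq_one)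
  \<comment> \<open>The factor \<open>h\<close> = e^(t/2) turns \<open>h + hi\<close> into E + 1 and
    \<open>h - hi\<close> into E - 1.\<close>
  then have "fps_tanh (1/2) * (h + hi) * h = (h - hi) * h"
    by simp
  then have *: "fps_tanh (1/2) * (fps_exp 1 + 1) = fps_exp 1 - 1"
    using hh hhi by algebra
  have "fps_tanh (1/2) = fps_tanh (1/2) * (fps_exp 1 + 1) * inv_exp_plus_1"
    using inv_exp_plus_1_mult by (simp add: mult_ac)
  with * show ?thesis by simp
qed

text \<open>As 2 E sinh t = (E + 1)(E - 1), the factor E + 1 cancels one J and E - 1 completes the
  odd power of T.\<close>

lemma tanh_kernel_mult_sinh:
  "tanh_kernel m * fps_sinh 1 = of_nat (2 * (2 * m + 1)) * fps_tanh (1/2) ^ (2 * m + 1)"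
proof -
  let ?E = "fps_exp 1 :: rat fps" and ?J = inv_exp_plus_1
  have "?E * fps_exp (-1) = 1"
    by (simp flip: fps_exp_add_mult)
  moreover have "2 * fps_sinh 1 = ?E - fps_exp (-1)"
    unfolding fps_sinh_def by (simp add: numeral_fps_const mult.assoc[symmetric])
  ultimately have sinh: "2 * (?E * fps_sinh 1) = (?E + 1) * (?E - 1)"
    by algebra
  have "tanh_kernel m * fps_sinh 1 =
      of_nat (2 * (2 * m + 1)) * (?E - 1) ^ (2 * m) * ?J ^ (2 * m + 2) * (2 * (?E * fps_sinh 1))"
    by (simp add: tanh_kernel_def mult_ac)
  also have "\<dots> = of_nat (2 * (2 * m + 1)) * (?E - 1) ^ (2 * m + 1) * ?J ^ (2 * m + 1) * (?J * (?E + 1))"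
    unfolding sinh by (simp add: mult_ac)
  finally show ?thesis
    by (simp only: inv_exp_plus_1_mult fps_tanh_half power_mult_distrib mult_ac mult_1)
qed

lemma exp_minus_1_power_nth_less:
  "n < r \<Longrightarrow> fps_nth ((fps_exp 1 - 1 :: rat fps) ^ r) n = 0"
  using startsby_zero_power_prefix[of "fps_exp 1 - 1 :: rat fps"] by simp

text \<open>The factor (E - 1)^(2m) starts at degree 2m; this makes the sum over m finite in each
  degree.\<close>

lemma tanh_kernel_nth_less:
  assumes "n < 2 * m" shows "fps_nth (tanh_kernel m) n = 0"
proof -
  have "tanh_kernel m = (fps_exp 1 - 1) ^ (2 * m) *
      (of_nat (4 * (2 * m + 1)) * fps_exp 1 * inv_exp_plus_1 ^ (2 * m + 2))"
    by (simp add: tanh_kernel_def mult_ac)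
  then show ?thesis
    using assms by (simp add: fps_mult_nth exp_minus_1_power_nth_less)
qed

lemma D_eq_sum_tanh_kernel:
  "D k n = (\<Sum>m=0..n div 2. 1 / of_nat (2 * m + 1) powi (k + 1) * (fact n * fps_nth (tanh_kernel m) n))"
proof -
  define c :: "nat \<Rightarrow> rat" where "c m = 1 / of_nat (2 * m + 1) powi (k + 1)" for m
  define S where "S = Abs_fps (\<lambda>n. \<Sum>m=0..n div 2. c m * fps_nth (tanh_kernel m) n)"
  \<comment> \<open>A bound on m that does not depend on i allows the two sums in the product with
    sinh to be swapped.\<close>
  have S_nth: "fps_nth S i = (\<Sum>m=0..j. c m * fps_nth (tanh_kernel m) i)" if "i \<le> j" for i j
    unfolding S_def fps_nth_Abs_fps
    by (rule sum.mono_neutral_left) (use that in \<open>auto intro: tanh_kernel_nth_less\<close>)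
  have "S * fps_sinh 1 = fps_A k oo fps_tanh (1/2)"
  proof (rule fps_ext)
    fix j
    let ?T = "fps_tanh (1/2)"
    have "fps_nth (S * fps_sinh 1) j =
        (\<Sum>i=0..j. \<Sum>m=0..j. c m * (fps_nth (tanh_kernel m) i * fps_nth (fps_sinh 1) (j - i)))"
      by (simp add: fps_mult_nth S_nth sum_distrib_right mult.assoc)
    also have "\<dots> = (\<Sum>m=0..j. c m * fps_nth (tanh_kernel m * fps_sinh 1) j)"
      by (subst sum.swap) (simp add: fps_mult_nth sum_distrib_left)
    also have "\<dots> = (\<Sum>m=0..j. fps_nth (fps_A k) (2 * m + 1) * fps_nth (?T ^ (2 * m + 1)) j)"
    proof (rule sum.cong[OF refl])
      fix m
      define y :: rat where "y = of_nat (2 * m + 1)"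
      have "y \<noteq> 0"
        unfolding y_def by (simp only: of_nat_eq_0_iff)
      \<comment> \<open>The factor 2m + 1 of the kernel lowers the exponent from k + 1 to that of
        \<open>fps_A k\<close>.\<close>
      then have "1 / y powi (k + 1) * (2 * y) = 2 * (1 / y powi k)"
        by (simp add: power_int_add)
      then have "c m * of_nat (2 * (2 * m + 1)) = fps_nth (fps_A k) (2 * m + 1)"
        by (simp add: c_def fps_A_def y_def)
      then show "c m * fps_nth (tanh_kernel m * fps_sinh 1) j =
          fps_nth (fps_A k) (2 * m + 1) * fps_nth (?T ^ (2 * m + 1)) j"
        unfolding tanh_kernel_mult_sinh
        by (metis fps_mult_left_const_nth fps_of_nat mult.assoc)
    qed
    also have "\<dots> = (\<Sum>i\<in>(\<lambda>m. 2 * m + 1) ` {0..j}. fps_nth (fps_A k) i * fps_nth (?T ^ i) j)"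
      by (subst sum.reindex) (auto simp: inj_on_def)
    \<comment> \<open>Even indices may be added since A is odd; then those above j drop out since
      T^i starts at degree i or later.\<close>
    also have "\<dots> = (\<Sum>i\<in>{0..2 * j + 1}. fps_nth (fps_A k) i * fps_nth (?T ^ i) j)"
    proof (rule sum.mono_neutral_left)
      show "\<forall>i\<in>{0..2 * j + 1} - (\<lambda>m. 2 * m + 1) ` {0..j}.
          fps_nth (fps_A k) i * fps_nth (?T ^ i) j = 0"
        by (auto simp: fps_A_def elim!: oddE)
    qed auto
    also have "\<dots> = (\<Sum>i\<in>{0..j}. fps_nth (fps_A k) i * fps_nth (?T ^ i) j)"
      by (rule sum.mono_neutral_right)
        (auto simp: startsby_zero_power_prefix[OF fps_tanh_nth_0])
    finally show "fps_nth (S * fps_sinh 1) j = fps_nth (fps_A k oo ?T) j"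
      by (simp add: fps_compose_nth)
  qed
  moreover have "fps_nth (fps_sinh 1) 1 \<noteq> 0"
    by (simp add: fps_sinh_def)
  then have "fps_sinh 1 \<noteq> 0"
    by auto
  ultimately have "Abs_fps (\<lambda>n. D k n / fact n) = S"
    using D_egf[of k] by (metis mult_right_cancel)
  then have "D k n / fact n = fps_nth S n"
    by (metis fps_nth_Abs_fps)
  then show ?thesis
    by (simp add: S_def c_def field_simps sum_distrib_left)
qed

section \<open>Stirling numbers and the exponential series\<close>

text \<open>With u = E - 1, the derivative of u^r is r (u^r + u^(r-1)), which on coefficients is the
  recurrence of the Stirling numbers.\<close>

lemma fps_nth_exp_minus_1_power:
  "fps_nth ((fps_exp 1 - 1 :: rat fps) ^ r) n = fact r * of_nat (Stirling n r) / fact n"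
proof (induction n arbitrary: r)
  case 0
  then show ?case by (cases r) simp_all
next
  case (Suc n)
  show ?case
  proof (cases r)
    case 0
    then show ?thesis by simp
  next
    case [simp]: (Suc r')
    let ?u = "fps_exp 1 - 1 :: rat fps"
    have "fps_exp 1 * ?u ^ r' = ?u ^ r + ?u ^ r'"
      by (simp add: algebra_simps)
    then have "fps_deriv (?u ^ r) = of_nat r * (?u ^ r + ?u ^ r')"
      by (simp add: fps_deriv_power' mult.assoc del: of_nat_Suc power_Suc)
    then have "fps_nth (fps_deriv (?u ^ r)) n = of_nat r * (fps_nth (?u ^ r) n + fps_nth (?u ^ r') n)"
      by (metis fps_add_nth fps_mult_left_const_nth fps_of_nat)
    then have "of_nat (Suc n) * fps_nth (?u ^ r) (Suc n) =
        of_nat r * (fact r * of_nat (Stirling n r) / fact n + fact r' * of_nat (Stirling n r') / fact n)"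
      by (simp only: Suc.IH fps_deriv_nth Suc_eq_plus1)
    also have "\<dots> = of_nat (Suc n) * (fact r * of_nat (Stirling (Suc n) r) / fact (Suc n))"
      by (simp add: field_simps del: of_nat_Suc) (simp add: algebra_simps)
    finally show ?thesis
      by (metis mult_left_cancel of_nat_eq_0_iff nat.distinct(1))
  qed
qed

text \<open>The sum is \<partial>(\<partial> + 1)...(\<partial> + N - 1) applied to
  \<open>f 0\<close>; the recurrence of \<open>stirling\<close> appends the factor \<partial> +
  N.\<close>

lemma stirling_sum_deriv:
  fixes f :: "nat \<Rightarrow> 'a::comm_semiring_1 fps"
  assumes "\<And>p. fps_deriv (f p) = f (Suc p)"
  shows "(\<Sum>p\<le>Suc N. of_nat (stirling (Suc N) p) * f p) =
    of_nat N * (\<Sum>p\<le>N. of_nat (stirling N p) * f p) +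
    fps_deriv (\<Sum>p\<le>N. of_nat (stirling N p) * f p)"
proof -
  have "(\<Sum>p\<le>Suc N. of_nat (stirling (Suc N) p) * f p) =
      (\<Sum>p\<le>N. of_nat N * (of_nat (stirling N (Suc p)) * f (Suc p))) +
      (\<Sum>p\<le>N. of_nat (stirling N p) * f (Suc p))"
    by (simp add: sum.atMost_Suc_shift sum.distrib algebra_simps del: sum.atMost_Suc)
  \<comment> \<open>The new term p = 0 vanishes: either N = 0 or
    \<open>stirling N 0 = 0\<close>.\<close>
  also have "(\<Sum>p\<le>N. of_nat N * (of_nat (stirling N (Suc p)) * f (Suc p))) =
      of_nat N * (\<Sum>p\<le>Suc N. of_nat (stirling N p) * f p)"
    by (cases N) (simp_all add: sum.atMost_Suc_shift sum_distrib_left distrib_left del: sum.atMost_Suc)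
  also have "(\<Sum>p\<le>Suc N. of_nat (stirling N p) * f p) = (\<Sum>p\<le>N. of_nat (stirling N p) * f p)"
    by simp
  finally show ?thesis
    by (simp add: fps_deriv_sum assms)
qed

section \<open>The Bernoulli number formula\<close>

definition bernoulli_quot :: "nat \<Rightarrow> rat" where
  "bernoulli_quot j = (2 ^ (j + 1) - 1) * (bernoulli (j + 1) / of_nat (j + 1))"

text \<open>Shifting the sequence by p differentiates its exponential generating function p
  times.\<close>

definition bernoulli_quot_egf :: "nat \<Rightarrow> rat fps" where
  "bernoulli_quot_egf p = Abs_fps (\<lambda>q. bernoulli_quot (p + q) / fact q)"

lemma fps_deriv_bernoulli_quot_egf:
  "fps_deriv (bernoulli_quot_egf p) = bernoulli_quot_egf (Suc p)"
  by (rule fps_ext) (simp add: bernoulli_quot_egf_def field_simps del: of_nat_Suc)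

text \<open>With \<open>b = t/(e\<^sup>t - 1)\<close>, the left-hand side times \<open>t\<close> is \<open>b(2t) - b(t)\<close>.\<close>

lemma bernoulli_quot_egf_0: "bernoulli_quot_egf 0 = - inv_exp_plus_1"
proof -
  let ?E = "fps_exp 1 :: rat fps" and ?J = inv_exp_plus_1 and ?F = "bernoulli_quot_egf 0"
  define b where "b = Abs_fps (\<lambda>j. bernoulli j / fact j)"
  define b2 where "b2 = b oo (fps_const 2 * fps_X)"
  have b: "b * (?E - 1) = fps_X"
    unfolding b_def by (rule bernoulli_egf)
  have "(b * (?E - 1)) oo (fps_const 2 * fps_X) = fps_X oo (fps_const 2 * fps_X)"
    by (simp only: b)
  then have b2: "b2 * (?E * ?E - 1) = fps_const 2 * fps_X"
    unfolding b2_def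
    by (simp add: fps_compose_mult_distrib fps_compose_sub_distrib flip: fps_exp_add_mult)
  have b2_nth: "fps_nth b2 j = 2 ^ j * bernoulli j / fact j" for j
    unfolding b2_def fps_compose_linear b_def by simp
  have F: "fps_X * ?F = b2 - b"
  proof (rule fps_ext)
    fix j show "fps_nth (fps_X * ?F) j = fps_nth (b2 - b) j"
      by (cases j) (simp_all add: b2_nth b_def bernoulli_quot_egf_def bernoulli_quot_def field_simps del: of_nat_Suc)
  qed
  \<comment> \<open>The factor E^2 - 1 clears the denominators of b(2t) and b(t) at once.\<close>
  have "fps_X * (?E - 1) * (?F * (?E + 1)) = (b2 - b) * (?E * ?E - 1)"
    unfolding F[symmetric] by (simp add: algebra_simps)
  also have "\<dots> = fps_const 2 * fps_X - (b * (?E - 1)) * (?E + 1)"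
    unfolding b2[symmetric] by (simp add: algebra_simps)
  also have "\<dots> = fps_X * (?E - 1) * (- 1)"
    unfolding b by (simp add: algebra_simps flip: numeral_fps_const)
  finally have "?F * (?E + 1) = - 1"
    by (subst (asm) mult_left_cancel) simp_all
  then show ?thesis
    using inv_exp_plus_1_mult by algebra
qed

text \<open>Applying \<partial> + M to E J^(M+1) gives (M + 1) E J^(M+1) (1 - E J), and 1 - E J = J.
  The induction starts at M = 1, because for M = 0 the sum is -J and not E J.\<close>

lemma stirling_sum_bernoulli_quot_egf:
  "(\<Sum>p\<le>Suc N. of_nat (stirling (Suc N) p) * bernoulli_quot_egf p) =
     fact (Suc N) * fps_exp 1 * inv_exp_plus_1 ^ (N + 2)"
proof (induction N)
  case 0
  have "bernoulli_quot_egf (Suc 0) = fps_deriv (bernoulli_quot_egf 0)"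
    by (simp add: fps_deriv_bernoulli_quot_egf)
  then show ?case
    by (simp add: bernoulli_quot_egf_0 fps_deriv_inv_exp_plus_1 power2_eq_square)
next
  case (Suc N)
  let ?E = "fps_exp 1 :: rat fps" and ?J = inv_exp_plus_1
  let ?n = "of_nat (Suc N) :: rat fps"
  have deriv: "fps_deriv (fact (Suc N) * ?E * ?J ^ (N + 2)) =
      fact (Suc N) * (?E * ?J ^ (N + 2) - (?n + 1) * ?E * (?E * ?J) * ?J ^ (N + 2))"
  proof -
    have fact: "fps_deriv (fact (Suc N) :: rat fps) = 0"
      by (metis fps_const_fact fps_deriv_const)
    have J: "fps_deriv (?J ^ (N + 2)) = - ((?n + 1) * ?E * ?J ^ (N + 3))"
      unfolding fps_deriv_power'
      by (simp add: fps_deriv_inv_exp_plus_1 power2_eq_square eval_nat_numeral mult_ac)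
    show ?thesis
      unfolding fps_deriv_mult fact J fps_exp_deriv
      by (simp add: eval_nat_numeral algebra_simps del: fact_Suc of_nat_Suc)
  qed
  show ?case
    unfolding stirling_sum_deriv[where f = bernoulli_quot_egf and N = "Suc N", OF fps_deriv_bernoulli_quot_egf]
      Suc.IH deriv exp_mult_inv_exp_plus_1
    by (simp add: algebra_simps)
qed

lemma tanh_kernel_nth_bernoulli:
  "fact n * fps_nth (tanh_kernel m) n =
     4 * (\<Sum>p=1..2 * m + 1. \<Sum>q=0..n - 2 * m.
          (2 ^ (p + q + 1) - 1) * of_nat (n choose q) * of_nat (stirling (2 * m + 1) p) *
          of_nat (Stirling (n - q) (2 * m)) * (bernoulli (p + q + 1) / of_nat (p + q + 1)))"
proof -
  let ?u = "fps_exp 1 - 1 :: rat fps"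
  let ?s = "\<lambda>p. of_nat (stirling (2 * m + 1) p)"
  \<comment> \<open>By the operator identity with \<open>N = 2 * m\<close>, this is (2m + 1)! E
    J^(2m+2) (E - 1)^(2m), a quarter of (2m)! times the kernel.\<close>
  define G where "G = (\<Sum>p=1..2 * m + 1. fps_const (?s p) * (bernoulli_quot_egf p * ?u ^ (2 * m)))"
  have "G = (\<Sum>p=1..2 * m + 1. of_nat (stirling (2 * m + 1) p) * bernoulli_quot_egf p) * ?u ^ (2 * m)"
    by (simp add: G_def sum_distrib_right fps_of_nat mult.assoc del: sum.cl_ivl_Suc)
  also have "(\<Sum>p=1..2 * m + 1. of_nat (stirling (2 * m + 1) p) * bernoulli_quot_egf p) =
      (\<Sum>p\<le>Suc (2 * m). of_nat (stirling (Suc (2 * m)) p) * bernoulli_quot_egf p)"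
    by (rule sum.mono_neutral_cong_left) (auto simp: not_less_eq_eq)
  finally have "4 * G = fact (2 * m) * tanh_kernel m"
    unfolding stirling_sum_bernoulli_quot_egf tanh_kernel_def
    by (simp add: algebra_simps)
  then have "fps_nth (fps_const 4 * G) n = fps_nth (fps_const (fact (2 * m)) * tanh_kernel m) n"
    by (simp add: numeral_fps_const fps_const_fact)
  then have kernel: "fact (2 * m) * fps_nth (tanh_kernel m) n = 4 * fps_nth G n"
    by simp
  have summand: "fact n * fps_nth (bernoulli_quot_egf p * ?u ^ (2 * m)) n =
      fact (2 * m) * (\<Sum>q=0..n - 2 * m. bernoulli_quot (p + q) * of_nat (n choose q) *
         of_nat (Stirling (n - q) (2 * m)))" for p
  proof -
    have "fact n * fps_nth (bernoulli_quot_egf p * ?u ^ (2 * m)) n =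
        (\<Sum>q=0..n. fact (2 * m) * (bernoulli_quot (p + q) * of_nat (n choose q) *
         of_nat (Stirling (n - q) (2 * m))))"
      unfolding fps_mult_nth sum_distrib_left
      by (rule sum.cong)
        (simp_all add: bernoulli_quot_egf_def fps_nth_exp_minus_1_power binomial_fact field_simps)
    \<comment> \<open>For larger q the number \<open>Stirling (n - q) (2 * m)\<close>
      vanishes.\<close>
    also have "\<dots> = (\<Sum>q=0..n - 2 * m. fact (2 * m) * (bernoulli_quot (p + q) * of_nat (n choose q) *
         of_nat (Stirling (n - q) (2 * m))))"
      by (rule sum.mono_neutral_right) auto
    finally show ?thesis
      by (simp add: sum_distrib_left)
  qed
  have "fact (2 * m) * (fact n * fps_nth (tanh_kernel m) n) =
      4 * (\<Sum>p=1..2 * m + 1. ?s p * (fact n * fps_nth (bernoulli_quot_egf p * ?u ^ (2 * m)) n))"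
  proof -
    have "fps_nth G n = (\<Sum>p=1..2 * m + 1. ?s p * fps_nth (bernoulli_quot_egf p * ?u ^ (2 * m)) n)"
      unfolding G_def fps_sum_nth fps_mult_left_const_nth ..
    moreover have "fact (2 * m) * (fact n * fps_nth (tanh_kernel m) n) = fact n * (4 * fps_nth G n)"
      using kernel by (simp only: mult.left_commute)
    ultimately show ?thesis
      by (simp add: sum_distrib_left mult.left_commute[of "fact n"] del: sum.cl_ivl_Suc)
  qed
  also have "\<dots> = fact (2 * m) * (4 * (\<Sum>p=1..2 * m + 1. \<Sum>q=0..n - 2 * m.
          (2 ^ (p + q + 1) - 1) * of_nat (n choose q) * ?s p *
          of_nat (Stirling (n - q) (2 * m)) * (bernoulli (p + q + 1) / of_nat (p + q + 1))))"
    unfolding summand bernoulli_quot_def sum_distrib_left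
    by (intro sum.cong refl) (simp only: mult_ac)
  finally show ?thesis
    by (rule mult_left_cancel[OF fact_nonzero, THEN iffD1])
qed

section \<open>The formula by Stirling numbers of the second kind\<close>

text \<open>This is the series of x^r / (1 - x)^(r+1) at x = -t/2, with denominators
  cleared.\<close>

lemma binomial_gf:
  fixes r :: nat
  defines "w \<equiv> (\<lambda>r. Abs_fps (\<lambda>p. (- (1/2)) ^ p * of_nat (p choose r)) :: rat fps)"
  shows "w r * (fps_const 2 + fps_X) ^ (r + 1) = 2 * (- fps_X) ^ r"
proof (induction r)
  case 0
  show ?case
  proof (rule fps_ext)
    fix n show "fps_nth (w 0 * (fps_const 2 + fps_X) ^ (0 + 1)) n = fps_nth (2 * (- fps_X) ^ 0) n"
      by (cases n) (simp_all add: w_def distrib_left numeral_fps_const)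
  qed
next
  case (Suc r)
  \<comment> \<open>On coefficients this is Pascal's rule.\<close>
  have "w (Suc r) * (fps_const 2 + fps_X) = - fps_X * w r"
  proof (rule fps_ext)
    fix n show "fps_nth (w (Suc r) * (fps_const 2 + fps_X)) n = fps_nth (- fps_X * w r) n"
      by (cases n) (simp_all add: w_def distrib_left algebra_simps)
  qed
  then have "w (Suc r) * (fps_const 2 + fps_X) ^ (Suc r + 1) =
      - fps_X * (w r * (fps_const 2 + fps_X) ^ (r + 1))"
    by (simp add: mult.assoc[symmetric])
  then show ?case
    using Suc.IH by simp
qed

text \<open>T' = E J (1 - T) and 1 - T = 2 J, hence T' = 2 E J^2.\<close>

lemma tanh_kernel_eq_deriv:
  "tanh_kernel m = fps_deriv (2 * ((fps_exp 1 - 1) * inv_exp_plus_1) ^ (2 * m + 1))"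
proof -
  let ?E = "fps_exp 1 :: rat fps" and ?J = inv_exp_plus_1
  have "fps_deriv ((?E - 1) * ?J) = ?E * ?J - (?E - 1) * ?J * (?E * ?J)"
    by (simp add: fps_deriv_inv_exp_plus_1 power2_eq_square algebra_simps)
  also have "\<dots> = 2 * ?E * ?J * ?J"
    using exp_mult_inv_exp_plus_1 by algebra
  finally have *: "fps_deriv ((?E - 1) * ?J) = 2 * ?E * ?J * ?J" .
  have "fps_deriv (((?E - 1) * ?J) ^ (2 * m + 1)) =
      of_nat (2 * m + 1) * (2 * ?E * ?J * ?J) * ((?E - 1) * ?J) ^ (2 * m)"
    by (simp only: fps_deriv_power' * add_diff_cancel_right')
  then have "fps_deriv (fps_const 2 * ((?E - 1) * ?J) ^ (2 * m + 1)) =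
      fps_const 2 * (of_nat (2 * m + 1) * (2 * ?E * ?J * ?J) * ((?E - 1) * ?J) ^ (2 * m))"
    by (simp only: fps_deriv_mult_const_left)
  then show ?thesis
    by (simp add: tanh_kernel_def power_mult_distrib mult_ac flip: numeral_fps_const
        del: fps_deriv_mult fps_deriv_power power_Suc) (simp add: algebra_simps)
qed

lemma tanh_kernel_nth_Stirling:
  "fact n * fps_nth (tanh_kernel m) n =
     (\<Sum>p=2 * m..n. (- 1) ^ p * fact (p + 1) / 2 ^ p * of_nat (p choose (2 * m)) *
        of_nat (Stirling (n + 1) (p + 1)))"
proof -
  let ?u = "fps_exp 1 - 1 :: rat fps" and ?J = inv_exp_plus_1
  define w :: "rat fps" where "w = Abs_fps (\<lambda>p. (- (1/2)) ^ p * of_nat (p choose (2 * m)))"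
  have "(w * (fps_const 2 + fps_X) ^ (2 * m + 1)) oo ?u = (2 * (- fps_X) ^ (2 * m)) oo ?u"
    unfolding w_def by (simp only: binomial_gf)
  moreover have "fps_const 2 + ?u = fps_exp 1 + 1"
    by (simp flip: numeral_fps_const)
  ultimately have "(w oo ?u) * (fps_exp 1 + 1) ^ (2 * m + 1) = 2 * ?u ^ (2 * m)"
    by (simp add: fps_compose_mult_distrib fps_compose_add_distrib fps_compose_power[symmetric]
        numeral_fps_const)
  then have "(w oo ?u) * (fps_exp 1 + 1) ^ (2 * m + 1) * ?J ^ (2 * m + 1) =
      2 * ?u ^ (2 * m) * ?J ^ (2 * m + 1)"
    by simp
  then have "(w oo ?u) * (?J * (fps_exp 1 + 1)) ^ (2 * m + 1) = 2 * ?u ^ (2 * m) * ?J ^ (2 * m + 1)"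
    by (simp only: power_mult_distrib mult_ac)
  \<comment> \<open>The extra \<open>fps_X\<close> becomes the factor u that completes T^(2m+1); the
    sign is gone because 2m is even.\<close>
  then have "(fps_X * w) oo ?u = 2 * (?u * ?J) ^ (2 * m + 1)"
    unfolding inv_exp_plus_1_mult
    by (simp add: fps_compose_mult_distrib power_mult_distrib mult_ac)
  then have "tanh_kernel m = fps_deriv ((fps_X * w) oo ?u)"
    by (simp add: tanh_kernel_eq_deriv)
  \<comment> \<open>The derivative shifts n to n + 1, and the factor \<open>fps_X\<close> shifts p
    to p + 1 below.\<close>
  then have "fact n * fps_nth (tanh_kernel m) n =
      fact (n + 1) * (\<Sum>i=0..Suc n. fps_nth (fps_X * w) i * fps_nth (?u ^ i) (n + 1))"
    by (simp add: fps_compose_nth del: sum.atLeast0_atMost_Suc)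
  also have "\<dots> = (\<Sum>p=0..n. fact (n + 1) * (fps_nth w p * fps_nth (?u ^ (p + 1)) (n + 1)))"
    by (subst sum.atLeast0_atMost_Suc_shift) (simp add: sum_distrib_left)
  also have "\<dots> = (\<Sum>p=0..n. (- 1) ^ p * fact (p + 1) / 2 ^ p * of_nat (p choose (2 * m)) *
        of_nat (Stirling (n + 1) (p + 1)))"
    unfolding fps_nth_exp_minus_1_power w_def
    by (intro sum.cong refl) (simp add: power_minus[of "1/2"] power_one_over del: fact_Suc)
  also have "\<dots> = (\<Sum>p=2 * m..n. (- 1) ^ p * fact (p + 1) / 2 ^ p * of_nat (p choose (2 * m)) *
        of_nat (Stirling (n + 1) (p + 1)))"
    by (rule sum.mono_neutral_right) auto
  finally show ?thesis .
qed

theorem theorem2p2: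
  fixes k :: int and n :: nat
  shows
    "D k n = 4 * (\<Sum>m=0..n div 2. 1 / of_nat (2 * m + 1) powi (k + 1) *
        (\<Sum>p=1..2 * m + 1. \<Sum>q=0..n - 2 * m.
          (2 ^ (p + q + 1) - 1) * of_nat (n choose q) * of_nat (stirling (2 * m + 1) p) *
          of_nat (Stirling (n - q) (2 * m)) * (bernoulli (p + q + 1) / of_nat (p + q + 1))))
     \<and>
     D k n = (\<Sum>m=0..n div 2. 1 / of_nat (2 * m + 1) powi (k + 1) *
        (\<Sum>p=2 * m..n.
          (- 1) ^ p * fact (p + 1) / 2 ^ p * of_nat (p choose (2 * m)) *
          of_nat (Stirling (n + 1) (p + 1))))"
proof
  show "D k n = 4 * (\<Sum>m=0..n div 2. 1 / of_nat (2 * m + 1) powi (k + 1) *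
        (\<Sum>p=1..2 * m + 1. \<Sum>q=0..n - 2 * m.
          (2 ^ (p + q + 1) - 1) * of_nat (n choose q) * of_nat (stirling (2 * m + 1) p) *
          of_nat (Stirling (n - q) (2 * m)) * (bernoulli (p + q + 1) / of_nat (p + q + 1))))"
    unfolding D_eq_sum_tanh_kernel tanh_kernel_nth_bernoulli
    by (simp only: sum_distrib_left[of 4] mult.left_commute[of 4])
  show "D k n = (\<Sum>m=0..n div 2. 1 / of_nat (2 * m + 1) powi (k + 1) *
        (\<Sum>p=2 * m..n.
          (- 1) ^ p * fact (p + 1) / 2 ^ p * of_nat (p choose (2 * m)) *
          of_nat (Stirling (n + 1) (p + 1))))"
    unfolding D_eq_sum_tanh_kernel tanh_kernel_nth_Stirling ..
qed

end
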